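(* Let $p_0\ge 1$ be the real number determined by $$\frac{\left(\sqrt 5/6\right)^{2p_0-1}}{\sqrt{p_0}-\frac{1}{2\sqrt{p_0}}}=\left(1-\sqrt{3/\pi}\right)\pi,$$ so that $p_0=1.8414$ to four decimal places. For real $p\ge 1$ define $$C(p):=\begin{cases}\sqrt{\dfrac{\pi}{3}}, & 1\le p\le p_0,\\[2mm] 1+\dfrac{1}{\sqrt{3\pi}}\,\dfrac{\left(\sqrt5/6\right)^{2p-1}}{\sqrt p-\frac{1}{2\sqrt p}}, & p>p_0.\end{cases}$$ Then for every real $p\ge 1$, $$\frac{1}{\pi}\int_{-\infty}^{\infty}\left(\frac{\sin^2 t}{t^2}\right)^p dt\;\le\; C(p)\,\frac{\sqrt{3/\pi}}{\sqrt p}\;\le\;\frac{1}{\sqrt p},$$ and the first two terms are equal, i.e. $\frac{1}{\pi}\int_{-\infty}^{\infty}\left(\frac{\sin^2 t}{t^2}\right)^p dt= C(p)\,\frac{\sqrt{3/\pi}}{\sqrt p}$, if and only if $p=1$. Further, $$\lim_{p\to\infty}\left(\frac{1}{\pi}\int_{-\infty}^{\infty}\left(\frac{\sin^2 t}{t^2}\right)^p dt\right)\Big/\frac{\sqrt{3/\pi}}{\sqrt p}=1.$$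
   Context: Here $p$ is a real variable. The integrand $\frac{\sin^2 t}{t^2}$ is understood to take the value $1$ at $t=0$. *)

theory Defs
  imports "HOL-Analysis.Analysis"
begin

definition p0_equation :: "real \<Rightarrow> bool" where
  "p0_equation p \<longleftrightarrow>
     (sqrt 5 / 6) powr (2 * p - 1) / (sqrt p - 1 / (2 * sqrt p)) = (1 - sqrt (3 / pi)) * pi"

text \<open>The description is meaningful because the equation has exactly one solution in
  \<open>[1, \<infinity>)\<close>; this is part of the theorem, not assumed here.\<close>

definition p0 :: real where
  "p0 = (THE p. p \<ge> 1 \<and> p0_equation p)"

definition C :: "real \<Rightarrow> real" where
  "C p = (if p \<le> p0 then sqrt (pi / 3)
          else 1 + 1 / sqrt (3 * pi) *
                 ((sqrt 5 / 6) powr (2 * p - 1) / (sqrt p - 1 / (2 * sqrt p))))"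

definition sinc_sq :: "real \<Rightarrow> real" where
  "sinc_sq t = (if t = 0 then 1 else (sin t)\<^sup>2 / t\<^sup>2)"

definition ball_integral :: "real \<Rightarrow> real" where
  "ball_integral p = 1 / pi * (LINT t|lborel. sinc_sq t powr p)"

end

(* Write I(p) for the normalised integral. For large p, compare sinc^2 with a Gaussian up to the cut-off
   6 / sqrt 5 and with t^-2 beyond it: this gives I(p) < C(p) sqrt (3 / (pi p)) for all p > p0. For
   1 < p <= p0 the claim is I(p) < 1 / sqrt p. By Jensen's inequality for the probability density
   sinc^2 / pi, a bound I(q) <= a gives I(p) <= a^((p - 1) / (q - 1)) for 1 <= p <= q. With q = 2 and
   I(2) = 2/3 this suffices for p > 3/2. With q = 3/2 it suffices for p <= 3/2 as soon as
   I(3/2) <= exp (-1/4); here the signed integral of sinc^3 is exactly 3 pi / 4, and the absolute value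
   adds only a small contribution from the intervals where sin is negative. The limit follows from the
   upper bound and from sinc^(2p) >= exp (-p t^2 / 3) (1 - p t^4 / 9), via the fourth Gaussian moment. *)

theory Submission
  imports Defs "HOL-Probability.Sinc_Integral" "HOL-Real_Asymp.Real_Asymp"
begin

subsection \<open>Integrals of powers of the cardinal sine\<close>

text \<open>Nonnegativity of the integrand makes integrability part of the conclusion. The endpoints
  enter only as limits of \<open>F\<close>, since most antiderivatives below have x in a
  denominator.\<close>

lemma has_bochner_integral_FTC_greaterThan:
  fixes f F :: "real \<Rightarrow> real"
  assumes F: "\<And>x. a < x \<Longrightarrow> DERIV F x :> f x"
    and f: "\<And>x. a < x \<Longrightarrow> isCont f x"
    and nonneg: "\<And>x. a < x \<Longrightarrow> 0 \<le> f x"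
    and A: "(F \<longlongrightarrow> A) (at_right a)"
    and B: "(F \<longlongrightarrow> B) at_top"
  shows "has_bochner_integral lborel (\<lambda>x. indicator {a<..} x * f x) (B - A)"
proof -
  have l: "((F \<circ> real_of_ereal) \<longlongrightarrow> A) (at_right (ereal a))"
    using A by (simp add: ereal_tendsto_simps)
  have r: "((F \<circ> real_of_ereal) \<longlongrightarrow> B) (at_left \<infinity>)"
    using B by (simp add: ereal_tendsto_simps)
  have "set_integrable lborel (einterval (ereal a) \<infinity>) f"
       "(LBINT x=ereal a..\<infinity>. f x) = B - A"
    by (rule interval_integral_FTC_nonneg[where F=F, OF _ _ _ _ l r]; use assms in simp)+
  then show ?thesis
    by (simp add: has_bochner_integral_iff set_integrable_def set_lebesgue_integral_def
          interval_lebesgue_integral_def)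
qed

text \<open>The fundamental theorem above works on an open half-line, the reflection rule on a
  closed one; they differ by a null set.\<close>

lemma has_bochner_integral_even_greaterThan:
  fixes f :: "real \<Rightarrow> real"
  assumes I: "has_bochner_integral lborel (\<lambda>x. indicator {0<..} x * f x) I"
    and even: "\<And>x. f (- x) = f x"
    and [measurable]: "f \<in> borel_measurable borel"
  shows "has_bochner_integral lborel f (2 * I)"
proof -
  have "has_bochner_integral lborel (\<lambda>x. indicator {0..} x *\<^sub>R f x) I"
  proof (rule has_bochner_integralI_AE[OF I])
    show "AE x in lborel. indicator {0<..} x * f x = indicator {0..} x *\<^sub>R f x"
      using AE_lborel_singleton[of 0] by eventually_elim (auto split: split_indicator)
  qed simp
  from has_bochner_integral_even_function[OF this even] show ?thesis by simp
qed

lemma tendsto_bounded_divide_at_top: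
  fixes g h :: "real \<Rightarrow> real"
  assumes "\<And>x. \<bar>g x\<bar> \<le> c" and "filterlim h at_top at_top"
  shows "((\<lambda>x. g x / h x) \<longlongrightarrow> 0) at_top"
proof (rule Lim_null_comparison)
  have "eventually (\<lambda>x. h x > 0) at_top"
    using assms(2) by (simp add: filterlim_at_top_dense)
  then show "eventually (\<lambda>x. norm (g x / h x) \<le> c / h x) at_top"
    by eventually_elim (simp add: assms(1) divide_right_mono)
  show "((\<lambda>x. c / h x) \<longlongrightarrow> 0) at_top"
    using assms(2) by (intro tendsto_divide_0[OF tendsto_const] filterlim_at_top_imp_at_infinity)
qed

section \<open>Derivative and limits of the scaled sine integral\<close>

lemma DERIV_Si_scale:
  assumes "x > 0" "c \<noteq> 0"
  shows "((\<lambda>x. Si (c * x)) has_real_derivative sin (c * x) / x) (at x)"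
proof -
  have "((\<lambda>x. Si (c * x)) has_real_derivative sinc (c * x) * c) (at x)"
    by (rule DERIV_chain2[where g = "\<lambda>x. c * x", OF DERIV_Si]) (auto intro!: derivative_eq_intros)
  then show ?thesis
    using assms by (simp add: field_simps)
qed

lemma Si_scale_at_top:
  assumes "c > 0"
  shows "((\<lambda>x. Si (c * x)) \<longlongrightarrow> pi / 2) at_top"
  by (rule filterlim_compose[OF Si_at_top])
     (use assms in \<open>real_asymp\<close>)

lemma Si_scale_at_0: "((\<lambda>x. Si (c * x)) \<longlongrightarrow> 0) (at_right 0)"
proof -
  have "isCont (\<lambda>x. Si (c * x)) 0"
    by (intro isCont_o2[OF _ isCont_Si] continuous_intros)
  moreover have "Si 0 = 0" by (simp add: Si_def flip: zero_ereal_def)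
  ultimately show ?thesis
    by (auto simp: isCont_def intro: tendsto_mono[OF at_le])
qed

lemma abs_sin_power_le_1: "\<bar>sin x ^ n\<bar> \<le> (1::real)"
  by (simp add: power_abs power_le_one)

text \<open>Integration by parts turns sin^2 x / x^2 into sin (2 x) / x, whose antiderivative is
  \<open>Si (2 * x)\<close>.\<close>

lemma has_bochner_integral_sinc_sq: "has_bochner_integral lborel sinc_sq pi"
proof -
  let ?F = "\<lambda>x. - ((sin x)\<^sup>2 / x) + Si (2 * x)"
  have "has_bochner_integral lborel (\<lambda>x. indicator {0<..} x * ((sin x)\<^sup>2 / x\<^sup>2)) (pi / 2 - 0)"
  proof (rule has_bochner_integral_FTC_greaterThan[where F = ?F])
    fix x :: real assume x: "0 < x"
    show "DERIV ?F x :> (sin x)\<^sup>2 / x\<^sup>2"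
      by (rule derivative_eq_intros DERIV_Si_scale refl | use x in \<open>simp add: sin_double divide_simps power2_eq_square\<close>)+
    show "isCont (\<lambda>x. (sin x)\<^sup>2 / x\<^sup>2) x"
      using x by (intro continuous_intros) auto
  next
    have "((\<lambda>x. - ((sin x)\<^sup>2 / x)) \<longlongrightarrow> 0) (at_right (0::real))" by real_asymp
    then show "(?F \<longlongrightarrow> 0) (at_right 0)"
      using tendsto_add[OF _ Si_scale_at_0] by fastforce
    have "((\<lambda>x::real. - ((sin x)\<^sup>2 / x)) \<longlongrightarrow> - 0) at_top"
      by (intro tendsto_minus tendsto_bounded_divide_at_top[where c=1] filterlim_ident) (simp add: power_le_one abs_square_le_1)
    then show "(?F \<longlongrightarrow> pi / 2) at_top"
      using tendsto_add[OF _ Si_scale_at_top] by fastforce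
  qed simp
  then have "has_bochner_integral lborel (\<lambda>x. indicator {0<..} x * sinc_sq x) (pi / 2)"
    by (elim has_bochner_integral_cong[THEN iffD1, rotated 3]) (auto simp: sinc_sq_def split: split_indicator)
  from has_bochner_integral_even_greaterThan[OF this]
  show ?thesis by (simp add: sinc_sq_def[abs_def])
qed

text \<open>Three integrations by parts lower x^4 to x. The third derivative of sin^4 is a
  combination of sin (2 x) and sin (4 x), hence the two \<open>Si\<close> terms, worth (4/3 - 2/3)
  pi / 2 at infinity.\<close>

lemma has_bochner_integral_sinc_pow4: "has_bochner_integral lborel (\<lambda>x. (sinc_sq x)\<^sup>2) (2 * pi / 3)"
proof -
  let ?F = "\<lambda>x. - (sin x ^ 4 / (3 * x ^ 3)) - 2 * sin x ^ 3 * cos x / (3 * x\<^sup>2)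
              - (6 * (sin x)\<^sup>2 * (cos x)\<^sup>2 - 2 * sin x ^ 4) / (3 * x)
              - 2 / 3 * Si (2 * x) + 4 / 3 * Si (4 * x)"
  have "has_bochner_integral lborel (\<lambda>x. indicator {0<..} x * (sin x ^ 4 / x ^ 4)) (pi / 3 - 0)"
  proof (rule has_bochner_integral_FTC_greaterThan[where F = ?F])
    fix x :: real assume x: "0 < x"
    have s4: "sin (4 * x) = 4 * sin x * cos x * ((cos x)\<^sup>2 - (sin x)\<^sup>2)"
      using sin_double[of "2 * x"] by (simp add: sin_double cos_double)
    \<comment> \<open>\<open>s4'\<close> and \<open>s2\<close> are homogeneous quartics in sin and
      cos, so the derivative check becomes a polynomial identity that needs no further use of sin^2
      + cos^2 = 1.\<close>
    have s4': "sin (4 * x) = 4 * sin x * cos x ^ 3 - 4 * sin x ^ 3 * cos x"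
      unfolding s4 by algebra
    have s2: "sin (2 * x) = 2 * sin x * cos x ^ 3 + 2 * sin x ^ 3 * cos x"
      unfolding sin_double using sin_cos_squared_add[of x] by algebra
    show "DERIV ?F x :> sin x ^ 4 / x ^ 4"
      using x apply (auto intro!: derivative_eq_intros DERIV_Si_scale simp del: power_Suc)
      apply (simp add: s4' s2 divide_simps)
      apply (simp add: algebra_simps eval_nat_numeral)
      done
    show "isCont (\<lambda>x. sin x ^ 4 / x ^ 4) x"
      using x by (intro continuous_intros) auto
  next
    have "((\<lambda>x. - (sin x ^ 4 / (3 * x ^ 3)) - 2 * sin x ^ 3 * cos x / (3 * x\<^sup>2)
              - (6 * (sin x)\<^sup>2 * (cos x)\<^sup>2 - 2 * sin x ^ 4) / (3 * x)) \<longlongrightarrow> 0) (at_right (0::real))" by real_asymp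
    from tendsto_add[OF tendsto_diff[OF this tendsto_mult_left[OF Si_scale_at_0, of "2/3" 2]] tendsto_mult_left[OF Si_scale_at_0, of "4/3" 4]]
    show "(?F \<longlongrightarrow> 0) (at_right 0)" by simp
    have "((\<lambda>x::real. - (sin x ^ 4 / (3 * x ^ 3)) - (2 * sin x ^ 3 * cos x) / (3 * x\<^sup>2)
              - (6 * (sin x)\<^sup>2 * (cos x)\<^sup>2 - 2 * sin x ^ 4) / (3 * x)) \<longlongrightarrow> - 0 - 0 - 0) at_top"
    proof (intro tendsto_minus tendsto_diff)
      show "((\<lambda>x::real. sin x ^ 4 / (3 * x ^ 3)) \<longlongrightarrow> 0) at_top"
        by (rule tendsto_bounded_divide_at_top[OF abs_sin_power_le_1]) real_asymp
      have "\<bar>sin x ^ 3 * cos x\<bar> \<le> 1" for x :: real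
        unfolding abs_mult power_abs by (intro mult_le_one power_le_one) auto
      then have "\<bar>2 * sin x ^ 3 * cos x\<bar> \<le> 2" for x :: real
        by (metis abs_mult abs_numeral mult.assoc mult.right_neutral mult_left_mono zero_le_numeral)
      then show "((\<lambda>x::real. (2 * sin x ^ 3 * cos x) / (3 * x\<^sup>2)) \<longlongrightarrow> 0) at_top"
        by (rule tendsto_bounded_divide_at_top[where c=2]) real_asymp
      have "\<bar>6 * (sin x)\<^sup>2 * (cos x)\<^sup>2 - 2 * sin x ^ 4\<bar> \<le> 8" for x :: real
      proof -
        have "0 \<le> (sin x)\<^sup>2 * (cos x)\<^sup>2" "(sin x)\<^sup>2 * (cos x)\<^sup>2 \<le> 1" "0 \<le> sin x ^ 4" "sin x ^ 4 \<le> 1"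
          using abs_sin_power_le_1[of x 4] by (auto intro!: mult_le_one simp: abs_square_le_1)
        then show ?thesis by linarith
      qed
      then show "((\<lambda>x::real. (6 * (sin x)\<^sup>2 * (cos x)\<^sup>2 - 2 * sin x ^ 4) / (3 * x)) \<longlongrightarrow> 0) at_top"
        by (rule tendsto_bounded_divide_at_top) real_asymp
    qed
    from tendsto_add[OF tendsto_diff[OF this tendsto_mult_left[OF Si_scale_at_top, of 2 "2/3"]] tendsto_mult_left[OF Si_scale_at_top, of 4 "4/3"]]
    show "(?F \<longlongrightarrow> pi / 3) at_top" by simp
  qed simp
  then have "has_bochner_integral lborel (\<lambda>x. indicator {0<..} x * (sinc_sq x)\<^sup>2) (pi / 3)"
    by (elim has_bochner_integral_cong[THEN iffD1, rotated 3])
       (auto simp: sinc_sq_def power_divide split: split_indicator)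
  from has_bochner_integral_even_greaterThan[OF this]
  show ?thesis by (simp add: sinc_sq_def[abs_def])
qed

lemma isCont_sin_over: "x \<noteq> 0 \<Longrightarrow> isCont (\<lambda>x::real. sin x ^ n / x ^ n) x"
  by (intro continuous_intros) auto

text \<open>The integrand changes sign, so integrability is first obtained by domination by
  \<open>sinc_sq\<close>. The antiderivative comes from two integrations by parts, the second
  derivative of sin^3 being a combination of sin x and sin (3 x).\<close>

lemma has_bochner_integral_sinc_cubed:
  "has_bochner_integral lborel (\<lambda>x. indicator {0<..} x * (sin x ^ 3 / x ^ 3)) (3 * pi / 8)"
proof -
  let ?f = "\<lambda>x::real. sin x ^ 3 / x ^ 3"
  let ?F = "\<lambda>x. - (sin x ^ 3 / (2 * x\<^sup>2)) - 3 * (sin x)\<^sup>2 * cos x / (2 * x)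
              - 3 / 8 * Si x + 9 / 8 * Si (3 * x)"
  have int: "integrable lborel (\<lambda>x. indicator {0<..} x * ?f x)"
  proof (rule Bochner_Integration.integrable_bound[OF integrable.intros[OF has_bochner_integral_sinc_sq]])
    have "\<bar>sin x ^ 3 / x ^ 3\<bar> \<le> sinc_sq x" if "x > 0" for x
    proof -
      have "\<bar>sin x\<bar> \<le> x" using that abs_sin_x_le_abs_x[of x] by simp
      then have "\<bar>sin x\<bar> * (sin x)\<^sup>2 \<le> x * (sin x)\<^sup>2"
        by (rule mult_right_mono) simp
      then show ?thesis
        using that by (simp add: sinc_sq_def abs_mult power_abs field_simps power2_eq_square power3_eq_cube)
    qed
    then show "AE x in lborel. norm (indicator {0<..} x * ?f x) \<le> norm (sinc_sq x)"
      by (intro AE_I2) (auto split: split_indicator simp: sinc_sq_def intro: order_trans)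
  qed simp
  have "(LBINT x=ereal 0..\<infinity>. ?f x) = 3 * pi / 8 - 0"
  proof (rule interval_integral_FTC_integrable[where F = ?F])
    fix x :: real assume "ereal 0 < ereal x" then have x: "0 < x" by simp
    have s3: "sin (3 * x) = 3 * sin x * (cos x)\<^sup>2 - sin x ^ 3"
      using sin_add[of "2 * x" x] unfolding sin_double cos_double
      by (simp add: algebra_simps power2_eq_square power3_eq_cube)
    \<comment> \<open>Homogenised to degree 3, for the same purpose as in the fourth-power
      integral.\<close>
    have s1: "sin x = sin x ^ 3 + sin x * (cos x)\<^sup>2"
    proof -
      have "sin x ^ 3 + sin x * (cos x)\<^sup>2 = sin x * ((sin x)\<^sup>2 + (cos x)\<^sup>2)"
        by (simp only: distrib_left power2_eq_square power3_eq_cube mult.assoc)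
      then show ?thesis by simp
    qed
    have dSi: "DERIV Si x :> (sin x ^ 3 + sin x * (cos x)\<^sup>2) / x"
      using DERIV_Si[of x] x by (simp flip: s1)
    have "DERIV ?F x :> ?f x"
      using x apply (auto intro!: derivative_eq_intros dSi DERIV_Si_scale simp del: power_Suc)
      apply (simp add: s3 divide_simps)
      apply (simp add: algebra_simps eval_nat_numeral)
      done
    then show "(?F has_vector_derivative ?f x) (at x)"
      by (simp add: has_real_derivative_iff_has_vector_derivative)
    show "isCont ?f x" using x by (intro isCont_sin_over) auto
  next
    have "((\<lambda>x. - (sin x ^ 3 / (2 * x\<^sup>2)) - 3 * (sin x)\<^sup>2 * cos x / (2 * x)) \<longlongrightarrow> 0) (at_right (0::real))"
      by real_asymp
    from tendsto_add[OF tendsto_diff[OF this tendsto_mult_left[OF Si_scale_at_0[of 1, simplified], of "3/8"]]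
        tendsto_mult_left[OF Si_scale_at_0, of "9/8" 3]]
    show "((?F \<circ> real_of_ereal) \<longlongrightarrow> 0) (at_right (ereal 0))" by (simp add: ereal_tendsto_simps1)
    have "((\<lambda>x::real. - (sin x ^ 3 / (2 * x\<^sup>2)) - (3 * (sin x)\<^sup>2 * cos x) / (2 * x)) \<longlongrightarrow> - 0 - 0) at_top"
    proof (intro tendsto_minus tendsto_diff)
      show "((\<lambda>x::real. sin x ^ 3 / (2 * x\<^sup>2)) \<longlongrightarrow> 0) at_top"
        by (rule tendsto_bounded_divide_at_top[OF abs_sin_power_le_1]) real_asymp
      have "\<bar>(sin x)\<^sup>2 * cos x\<bar> \<le> 1" for x :: real
        unfolding abs_mult power_abs by (intro mult_le_one power_le_one) auto
      then have "\<bar>3 * (sin x)\<^sup>2 * cos x\<bar> \<le> 3" for x :: real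
        by (metis abs_mult abs_numeral mult.assoc mult.right_neutral mult_left_mono zero_le_numeral)
      then show "((\<lambda>x::real. (3 * (sin x)\<^sup>2 * cos x) / (2 * x)) \<longlongrightarrow> 0) at_top"
        by (rule tendsto_bounded_divide_at_top) real_asymp
    qed
    from tendsto_add[OF tendsto_diff[OF this tendsto_mult_left[OF Si_at_top, of "3/8"]]
        tendsto_mult_left[OF Si_scale_at_top, of 3 "9/8"]]
    show "((?F \<circ> real_of_ereal) \<longlongrightarrow> 3 * pi / 8) (at_left \<infinity>)" by (simp add: ereal_tendsto_simps1)
  qed (use int in \<open>simp_all add: set_integrable_def\<close>)
  with int show ?thesis
    by (simp add: has_bochner_integral_iff interval_lebesgue_integral_def set_lebesgue_integral_def)
qed

lemma has_bochner_integral_powr_tail: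
  fixes a c :: real
  assumes "a > 0" "c > 1"
  shows "has_bochner_integral lborel (\<lambda>x. indicator {a<..} x * x powr (- c)) (a powr (1 - c) / (c - 1))"
proof -
  let ?F = "\<lambda>x. x powr (1 - c) / (1 - c)"
  have "has_bochner_integral lborel (\<lambda>x. indicator {a<..} x * x powr (- c)) (0 - ?F a)"
  proof (rule has_bochner_integral_FTC_greaterThan[where F = ?F])
    fix x assume "a < x"
    with assms have x: "x > 0" by simp
    show "DERIV ?F x :> x powr (- c)"
      using DERIV_cdivide[OF has_real_derivative_powr[OF x, of "1 - c"], of "1 - c"] assms by simp
    show "isCont (\<lambda>x. x powr (- c)) x"
      using x by (intro continuous_intros) auto
  next
    have "isCont ?F a" using assms by (intro continuous_intros) auto
    then show "(?F \<longlongrightarrow> ?F a) (at_right a)"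
      unfolding isCont_def by (rule tendsto_mono[OF at_le, rotated]) simp
    show "(?F \<longlongrightarrow> 0) at_top" using assms by real_asymp
  qed simp
  moreover have "0 - ?F a = a powr (1 - c) / (c - 1)"
    using assms by (simp add: field_simps)
  ultimately show ?thesis by simp
qed

subsection \<open>Small exponents\<close>

lemma sinc_sq_nonneg: "0 \<le> sinc_sq t"
  by (simp add: sinc_sq_def)

lemma sinc_sq_le_1: "sinc_sq t \<le> 1"
proof (cases "t = 0")
  case False
  then show ?thesis
    using abs_sin_x_le_abs_x[of t] abs_le_square_iff[of "sin t" t] by (simp add: sinc_sq_def)
qed (simp add: sinc_sq_def)

lemma borel_measurable_sinc_sq [measurable]: "sinc_sq \<in> borel_measurable borel"
  by (simp add: sinc_sq_def[abs_def])

lemma integrable_sinc_sq_powr: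
  assumes "p \<ge> 1"
  shows "integrable lborel (\<lambda>t. sinc_sq t powr p)"
proof (rule Bochner_Integration.integrable_bound[OF integrable.intros[OF has_bochner_integral_sinc_sq]])
  have "sinc_sq t powr p \<le> sinc_sq t" for t
    using powr_mono'[of 1 p "sinc_sq t"] assms sinc_sq_nonneg[of t] sinc_sq_le_1[of t] by simp
  then show "AE t in lborel. norm (sinc_sq t powr p) \<le> norm (sinc_sq t)"
    using sinc_sq_nonneg by simp
qed simp

lemma ball_integral_1: "ball_integral 1 = 1"
  using has_bochner_integral_integral_eq[OF has_bochner_integral_sinc_sq] sinc_sq_nonneg
  by (simp add: ball_integral_def)

lemma ball_integral_2: "ball_integral 2 = 2 / 3"
  using has_bochner_integral_integral_eq[OF has_bochner_integral_sinc_pow4] sinc_sq_nonneg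
  by (simp add: ball_integral_def)

text \<open>Jensen's inequality for the probability density \<open>sinc_sq / pi\<close>, linearised at \<open>a\<close>.\<close>

lemma ball_integral_le_powr:
  assumes p: "1 \<le> p" "p \<le> q" and q: "1 < q" and a: "ball_integral q \<le> a" "0 < a"
  shows "ball_integral p \<le> a powr ((p - 1) / (q - 1))"
proof -
  define \<theta> where "\<theta> = (p - 1) / (q - 1)"
  have \<theta>: "0 \<le> \<theta>" "\<theta> \<le> 1" "p = (1 - \<theta>) + q * \<theta>"
proof -
    have "\<theta> * (q - 1) = p - 1" using q by (simp add: \<theta>_def)
    then show "p = (1 - \<theta>) + q * \<theta>" by (simp add: algebra_simps)
  qed (use p q in \<open>simp_all add: \<theta>_def\<close>)
  \<comment> \<open>Young's inequality with weights 1 - \<open>\<theta>\<close> and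
    \<open>\<theta>\<close> for s and s^q / a. Dividing by \<open>a\<close> makes the bracket
    integrate to at most pi.\<close>
  have pw: "sinc_sq t powr p \<le> a powr \<theta> * ((1 - \<theta>) * sinc_sq t powr 1 + \<theta> * (sinc_sq t powr q / a))" for t
  proof (cases "sinc_sq t = 0")
    case False
    define s where "s = sinc_sq t"
    have s: "s > 0" using False sinc_sq_nonneg[of t] by (simp add: s_def)
    have "s powr p = a powr \<theta> * (s powr (1 - \<theta>) * (s powr q / a) powr \<theta>)"
      using s a by (subst \<theta>(3)) (simp add: powr_add powr_divide powr_powr)
    also have "\<dots> \<le> a powr \<theta> * ((1 - \<theta>) * s + \<theta> * (s powr q / a))"
      using \<theta> s a by (intro mult_left_mono Youngs_inequality_0) auto
    finally show ?thesis using s by (simp add: s_def)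
  qed (use \<theta> in simp)
  note int = integrable_sinc_sq_powr[of 1] integrable_sinc_sq_powr[of p] integrable_sinc_sq_powr[of q]
  have "pi * ball_integral p = (LINT t|lborel. sinc_sq t powr p)"
    by (simp add: ball_integral_def)
  also have "\<dots> \<le> (LINT t|lborel. a powr \<theta> * ((1 - \<theta>) * sinc_sq t powr 1 + \<theta> * (sinc_sq t powr q / a)))"
    using int p q by (intro integral_mono pw) auto
  also have "\<dots> = a powr \<theta> * ((1 - \<theta>) * (pi * ball_integral 1) + \<theta> * (pi * ball_integral q / a))"
    using int p q by (simp add: ball_integral_def)
  also have "\<dots> \<le> a powr \<theta> * ((1 - \<theta>) * (pi * 1) + \<theta> * (pi * a / a))"
    using \<theta> a by (intro mult_left_mono add_mono divide_right_mono) (auto simp: ball_integral_1)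
  also have "\<dots> = pi * a powr \<theta>"
    using a by (simp add: algebra_simps)
  finally show ?thesis by (simp add: \<theta>_def)
qed

section \<open>The contribution of the intervals where sin is negative\<close>

lemma has_bochner_integral_neg_sin_cubed:
  fixes a b :: real
  assumes "a \<le> b"
  shows "has_bochner_integral lborel (\<lambda>x. - (sin x ^ 3) * indicator {a..b} x)
    ((cos b - cos b ^ 3 / 3) - (cos a - cos a ^ 3 / 3))"
proof (rule has_bochner_integral_FTC_Icc_real[where F = "\<lambda>x. cos x - cos x ^ 3 / 3", OF assms])
  fix x :: real
  have "(cos x)\<^sup>2 * sin x - sin x = - (sin x ^ 3)"
    by (simp add: cos_squared_eq left_diff_distrib power3_eq_cube power2_eq_square[of "sin x"])
  then show "DERIV (\<lambda>x. cos x - cos x ^ 3 / 3) x :> - (sin x ^ 3)"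
    by (auto intro!: derivative_eq_intros simp: mult.commute)
qed auto

text \<open>In units of \<open>pi\<close>, the cells cover the first two intervals on which \<open>sin\<close> is negative; they
  are fine enough to push the bound on \<open>ball_integral (3 / 2)\<close> below \<open>exp (- 1 / 4)\<close>.\<close>

definition sin_cells :: "(real \<times> real) list" where
  "sin_cells = [(1, 4 / 3), (4 / 3, 3 / 2), (3 / 2, 5 / 3), (5 / 3, 2), (3, 7 / 2), (7 / 2, 4)]"

lemma sin_cells_pos: "(a, b) \<in> set sin_cells \<Longrightarrow> 0 < a"
  by (auto simp: sin_cells_def)

text \<open>A majorant of the negative part of sin^3 t / t^3 for t > 0. Freezing the denominator at
  the left end of each cell leaves an elementary integral; beyond 5 pi the crude bound 1 for the
  numerator suffices. Between 4 pi and 5 pi sin is nonnegative.\<close>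

definition neg_cube_bound :: "real \<Rightarrow> real" where
  "neg_cube_bound t = (\<Sum>(a, b)\<leftarrow>sin_cells. - (sin t ^ 3) * indicator {a * pi..b * pi} t / (a * pi) ^ 3)
     + indicator {5 * pi<..} t * t powr (- 3)"

text \<open>The antiderivative cos - cos^3 / 3 gives 5/24, 11/24 or 2/3 on each cell; the fractions
  multiplying these are the inverse cubes of the left endpoints in units of pi.\<close>

lemma has_bochner_integral_neg_cube_bound:
  "has_bochner_integral lborel neg_cube_bound
     ((5 / 24 * (1 + 27 / 125) + 11 / 24 * (27 / 64 + 8 / 27) + 2 / 3 * (1 / 27 + 8 / 343)) / pi ^ 3
       + 1 / (50 * pi\<^sup>2))"
proof -
  have c: "cos (4 * pi / 3) = - 1 / 2" "cos (5 * pi / 3) = 1 / 2" "cos (3 * pi / 2) = 0"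
    "cos (7 * pi / 2) = 0" "cos (3 * pi) = - 1" "cos (4 * pi) = 1"
  proof -
    show "cos (4 * pi / 3) = - 1 / 2"
      using cos_periodic_pi[of "pi / 3"] by (simp add: cos_60 field_simps)
    show "cos (5 * pi / 3) = 1 / 2"
      using cos_2pi_minus[of "pi / 3"] by (simp add: cos_60 field_simps)
    show "cos (3 * pi / 2) = 0"
      using cos_3over2_pi by simp
    show "cos (7 * pi / 2) = 0"
      using cos_periodic[of "3 / 2 * pi"] cos_3over2_pi by (simp add: field_simps)
    show "cos (3 * pi) = - 1"
      using cos_periodic[of pi] by (simp add: field_simps)
    show "cos (4 * pi) = 1"
      using cos_periodic[of "2 * pi"] by (simp add: field_simps)
  qed
  note cell = has_bochner_integral_divide_zero[OF has_bochner_integral_neg_sin_cubed]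
  have tail: "has_bochner_integral lborel (\<lambda>t. indicator {5 * pi<..} t * t powr (- 3)) (1 / (50 * pi\<^sup>2))"
    using has_bochner_integral_powr_tail[of "5 * pi" 3]
    by (simp add: powr_minus powr_realpow power_mult_distrib field_simps)
  \<comment> \<open>The nesting mirrors the unfolded \<open>sum_list\<close>, whose empty end is the
    final zero integral.\<close>
  note sum = has_bochner_integral_add[OF has_bochner_integral_add[OF cell[of "(1 * pi) ^ 3" "1 * pi" "4 / 3 * pi"]
       has_bochner_integral_add[OF cell[of "(4 / 3 * pi) ^ 3" "4 / 3 * pi" "3 / 2 * pi"]
       has_bochner_integral_add[OF cell[of "(3 / 2 * pi) ^ 3" "3 / 2 * pi" "5 / 3 * pi"]
       has_bochner_integral_add[OF cell[of "(5 / 3 * pi) ^ 3" "5 / 3 * pi" "2 * pi"]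
       has_bochner_integral_add[OF cell[of "(3 * pi) ^ 3" "3 * pi" "7 / 2 * pi"]
       has_bochner_integral_add[OF cell[of "(7 / 2 * pi) ^ 3" "7 / 2 * pi" "4 * pi"] has_bochner_integral_zero]]]]]] tail]
  show ?thesis
    unfolding neg_cube_bound_def sin_cells_def list.map sum_list.Cons sum_list.Nil prod.case
    apply (rule back_subst[where P = "has_bochner_integral lborel _"], rule sum)
    apply (simp_all add: c)
    apply (simp add: power_mult_distrib power_divide)
    done
qed

text \<open>The absolute value of a number exceeds it by twice its negative part. Since all terms of
  the majorant are nonnegative, a single cell containing t suffices.\<close>

lemma neg_cube_bound:
  assumes "t > 0"
  shows "\<bar>sin t\<bar> ^ 3 / t ^ 3 \<le> sin t ^ 3 / t ^ 3 + 2 * neg_cube_bound t"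
proof -
  have cell_nonneg: "0 \<le> - (sin t ^ 3) * indicator {a * pi..b * pi} t / (a * pi) ^ 3"
    if "(a, b) \<in> set sin_cells" for a b
  proof (cases "t \<in> {a * pi..b * pi}")
    case True
    then have t: "a * pi \<le> t" "t \<le> b * pi" by auto
    have "sin t \<le> 0"
    proof -
      have "(1 \<le> a \<and> b \<le> 2) \<or> (3 \<le> a \<and> b \<le> 4)"
        using that by (auto simp: sin_cells_def)
      then consider "1 \<le> a" "b \<le> 2" | "3 \<le> a" "b \<le> 4" by blast
      then show ?thesis
      proof cases
        case 1
        then have "1 * pi \<le> a * pi" "b * pi \<le> 2 * pi"
          by (intro mult_right_mono; simp)+
        then have "1 * pi \<le> t" "t \<le> 2 * pi"
          using t by linarith+
        then show ?thesis using sin_ge_zero[of "t - pi"] by simp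
      next
        case 2
        then have "3 * pi \<le> a * pi" "b * pi \<le> 4 * pi"
          by (intro mult_right_mono; simp)+
        then have "3 * pi \<le> t" "t \<le> 4 * pi"
          using t by linarith+
        then show ?thesis using sin_ge_zero[of "t - 3 * pi"] sin_periodic[of "t - 2 * pi"]
          sin_periodic_pi[of "t - 3 * pi"] by (simp add: algebra_simps)
      qed
    qed
    moreover have "a > 0" using that by (auto simp: sin_cells_def)
    ultimately show ?thesis
      by (intro divide_nonneg_nonneg mult_nonneg_nonneg) (auto simp: power_le_zero_eq)
  qed simp
  have sum_nonneg: "0 \<le> (\<Sum>(a, b)\<leftarrow>sin_cells. - (sin t ^ 3) * indicator {a * pi..b * pi} t / (a * pi) ^ 3)"
    by (intro sum_list_nonneg) (use cell_nonneg in auto)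
  show ?thesis
  proof (cases "sin t \<ge> 0")
    case True
    then show ?thesis using sum_nonneg by (simp add: neg_cube_bound_def)
  next
    case False
    have "- (sin t ^ 3) / t ^ 3 \<le> neg_cube_bound t"
    proof (cases "t > 5 * pi")
      case True
      have "- (sin t ^ 3) \<le> 1" using abs_sin_power_le_1[of t 3] by linarith
      then have "- (sin t ^ 3) / t ^ 3 \<le> t powr (- 3)"
        using assms by (simp add: powr_minus powr_realpow field_simps)
      then show ?thesis using sum_nonneg True by (simp add: neg_cube_bound_def)
    next
      case le: False
      \<comment> \<open>The intervals where sin is nonnegative are excluded one by one; what remains
        up to 5 pi is covered by the cells.\<close>
      have "\<not> t \<le> pi" using False assms sin_ge_zero[of t] by auto
      moreover have "\<not> (2 * pi \<le> t \<and> t \<le> 3 * pi)"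
        using False sin_ge_zero[of "t - 2 * pi"] sin_periodic[of "t - 2 * pi"] by auto
      moreover have "\<not> 4 * pi \<le> t"
        using False le sin_ge_zero[of "t - 4 * pi"] sin_periodic[of "t - 2 * pi"] sin_periodic[of "t - 4 * pi"]
        by (auto simp: algebra_simps)
      ultimately have "\<exists>(a, b)\<in>set sin_cells. t \<in> {a * pi..b * pi}"
        using pi_gt_zero by (auto simp: sin_cells_def)
      then obtain a b where ab: "(a, b) \<in> set sin_cells" "t \<in> {a * pi..b * pi}" by auto
      then have "a > 0" by (auto simp: sin_cells_def)
      have "- (sin t ^ 3) / t ^ 3 \<le> - (sin t ^ 3) / (a * pi) ^ 3"
        using ab False \<open>a > 0\<close> assms
        by (intro divide_left_mono power_mono mult_pos_pos) (auto simp: power_le_zero_eq)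
      also have "\<dots> = - (sin t ^ 3) * indicator {a * pi..b * pi} t / (a * pi) ^ 3"
        using ab by simp
      also have "\<dots> \<le> (\<Sum>(a, b)\<leftarrow>sin_cells. - (sin t ^ 3) * indicator {a * pi..b * pi} t / (a * pi) ^ 3)"
        by (rule member_le_sum_list) (use ab cell_nonneg in \<open>auto intro: image_eqI[of _ _ "(a, b)"]\<close>)
      also have "\<dots> \<le> neg_cube_bound t"
        by (simp add: neg_cube_bound_def)
      finally show ?thesis .
    qed
    then show ?thesis using False by (simp add: power_minus_odd abs_if)
  qed
qed

text \<open>The value exp (-1/4) is chosen for Jensen's inequality: at exponent p it becomes exp
  (-(p - 1) / 2), which is below 1 / sqrt p because ln p < p - 1 for p > 1.\<close>

lemma ball_integral_three_halves: "ball_integral (3 / 2) \<le> exp (- 1 / 4)"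
proof -
  let ?N = "(5 / 24 * (1 + 27 / 125) + 11 / 24 * (27 / 64 + 8 / 27) + 2 / 3 * (1 / 27 + 8 / 343)) / pi ^ 3
       + 1 / (50 * pi\<^sup>2)"
  let ?h = "\<lambda>t. indicator {0<..} t * sinc_sq t powr (3 / 2)"
  have h: "sinc_sq t powr (3 / 2) = \<bar>sin t\<bar> ^ 3 / t ^ 3" if "t > 0" for t
  proof -
    have "sinc_sq t = (\<bar>sin t\<bar> / t) powr 2"
      using that by (simp add: sinc_sq_def power_divide)
    then have "sinc_sq t powr (3 / 2) = (\<bar>sin t\<bar> / t) powr 3"
      by (simp add: powr_powr)
    then show ?thesis using that by (simp add: power_divide)
  qed
  note int = integrable_sinc_sq_powr[of "3 / 2", simplified]
  have hint: "integrable lborel ?h"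
    by (rule Bochner_Integration.integrable_bound[OF int]) (auto split: split_indicator)
  have dom: "has_bochner_integral lborel
      (\<lambda>t. indicator {0<..} t * (sin t ^ 3 / t ^ 3) + 2 * neg_cube_bound t) (3 * pi / 8 + 2 * ?N)"
    by (intro has_bochner_integral_add has_bochner_integral_mult_right
        has_bochner_integral_sinc_cubed has_bochner_integral_neg_cube_bound)
  have "integral\<^sup>L lborel ?h \<le> 3 * pi / 8 + 2 * ?N"
    unfolding has_bochner_integral_integral_eq[OF dom, symmetric]
  proof (rule integral_mono[OF hint integrable.intros[OF dom]])
    fix t :: real
    \<comment> \<open>The majorant is integrated over the whole line, so the comparison is also due
      at t <= 0, where the other terms vanish by their indicators.\<close>
    have "neg_cube_bound t = 0" if "t \<le> 0"
    proof -
      have zero: "indicator {a * pi..b * pi} t = (0 :: real)" if "a > 0" for a b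
      proof -
        have "\<not> a * pi \<le> t"
          using \<open>t \<le> 0\<close> mult_pos_pos[OF that pi_gt_zero] by linarith
        then show ?thesis by simp
      qed
      have "map (\<lambda>(a, b). - (sin t ^ 3) * indicator {a * pi..b * pi} t / (a * pi) ^ 3) sin_cells
          = map (\<lambda>_. 0) sin_cells"
      proof (rule map_cong[OF refl])
        fix c assume "c \<in> set sin_cells"
        then show "(case c of (a, b) \<Rightarrow> - (sin t ^ 3) * indicator {a * pi..b * pi} t / (a * pi) ^ 3) = 0"
          using zero[OF sin_cells_pos, of "fst c" "snd c"] by (simp add: case_prod_unfold)
      qed
      then have sum0: "(\<Sum>(a, b)\<leftarrow>sin_cells. - (sin t ^ 3) * indicator {a * pi..b * pi} t / (a * pi) ^ 3) = 0"
        by (simp only: sum_list_0)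
      have "\<not> 5 * pi < t" using that pi_gt_zero by linarith
      then show ?thesis
        unfolding neg_cube_bound_def sum0 by simp
    qed
    then show "?h t \<le> indicator {0<..} t * (sin t ^ 3 / t ^ 3) + 2 * neg_cube_bound t"
      using h[of t] neg_cube_bound[of t] by (auto split: split_indicator)
  qed
  moreover have "integral\<^sup>L lborel (\<lambda>t. sinc_sq t powr (3 / 2)) = 2 * integral\<^sup>L lborel ?h"
    by (rule has_bochner_integral_integral_eq, rule has_bochner_integral_even_greaterThan)
       (use hint in \<open>auto simp: has_bochner_integral_iff sinc_sq_def\<close>)
  ultimately have "ball_integral (3 / 2) \<le> 3 / 4 + 4 / pi * ?N"
    by (simp add: ball_integral_def field_simps)
  also have "\<dots> \<le> 1 - 1 / 4 + 1 / 32 - 1 / 384"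
  proof -
    \<comment> \<open>The exponents 3 and 4 are those occurring in
      \<open>4 / pi * ?N\<close>.\<close>
    have "1 / pi ^ n \<le> 1 / (3141 / 1000) ^ n" for n
      using pi_approx by (intro divide_left_mono power_mono) auto
    from this[of 3] this[of 4] pi_approx show ?thesis
      by (simp add: field_simps eval_nat_numeral)
  qed
  also have "\<dots> \<le> exp (- 1 / 4)"
  proof -
    obtain t :: real where "exp (- 1 / 4) = (\<Sum>m<4. (- 1 / 4 :: real) ^ m / fact m) + exp t / fact 4 * (- 1 / 4) ^ 4"
      using Maclaurin_exp_le[of "- 1 / 4 :: real" 4] by blast
    moreover have "0 \<le> exp t / fact 4 * (- 1 / 4) ^ 4" by simp
    ultimately show ?thesis by (simp add: eval_nat_numeral)
  qed
  finally show ?thesis .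
qed

text \<open>Interpolating between \<open>1\<close> and \<open>2\<close> alone gives equality at \<open>p = 3 / 2\<close> and fails to the left of
  it; there one interpolates between \<open>1\<close> and \<open>3 / 2\<close>.\<close>

lemma ball_integral_less_inverse_sqrt:
  assumes p: "1 < p" "p \<le> 2"
  shows "ball_integral p < 1 / sqrt p"
proof -
  have sqrt: "1 / sqrt p = exp (- ln p / 2)"
  proof -
    have "sqrt p = exp (ln p / 2)"
      using p powr_half_sqrt[of p] by (simp add: powr_def)
    then show ?thesis
      by (simp add: exp_minus inverse_eq_divide)
  qed
  have ln_less: "ln x < x - 1" if "1 < x" for x :: real
    using that ln_le_minus_one[of x] ln_eq_minus_one[of x] by linarith
  show ?thesis
  proof (cases "p \<le> 3 / 2")
    case True
    have "ball_integral p \<le> exp (- 1 / 4) powr ((p - 1) / (3 / 2 - 1))"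
      using p True ball_integral_three_halves by (intro ball_integral_le_powr) auto
    also have "\<dots> = exp (- (p - 1) / 2)"
      by (simp add: powr_def field_simps)
    also have "\<dots> < exp (- ln p / 2)"
      using ln_less[OF p(1)] by simp
    finally show ?thesis by (simp add: sqrt)
  next
    case False
    have ln_inv: "ln (2 / 3) = - ln (3 / 2 :: real)"
      using ln_inverse[of "3 / 2 :: real"] by simp
    have "ball_integral p \<le> (2 / 3) powr ((p - 1) / (2 - 1))"
      using p by (intro ball_integral_le_powr) (auto simp: ball_integral_2)
    also have "\<dots> = exp (- (p - 1) * ln (3 / 2))"
      by (simp add: powr_def ln_inv algebra_simps)
    also have "\<dots> < exp (- ln p / 2)"
    proof -
      have l: "1 / 3 \<le> ln (3 / 2 :: real)"
        using ln_le_minus_one[of "2 / 3 :: real"] ln_inv by simp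
      \<comment> \<open>The goal amounts to ln p < 2 (p - 1) ln (3/2), with equality at p = 3/2.
        From there on ln lies below its tangent, whose slope 2/3 is at most 2 ln (3/2) by
        \<open>l\<close>.\<close>
      have "ln p - ln (3 / 2) = ln (p / (3 / 2))"
        using p by (intro ln_divide_pos[symmetric]) auto
      also have "\<dots> < p / (3 / 2) - 1"
        using False by (intro ln_less) simp
      also have "\<dots> = (2 * p - 3) * (1 / 3)" by simp
      also have "\<dots> \<le> (2 * p - 3) * ln (3 / 2)"
        using False l by (intro mult_left_mono) auto
      finally show ?thesis by (simp add: algebra_simps)
    qed
    finally show ?thesis by (simp add: sqrt)
  qed
qed

subsection \<open>Comparison with a Gaussian\<close>

text \<open>The weight is sqrt (3 pi / p) times the normal density of variance 3 / (2 p). The case k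
  = 0 gives the main term, k = 2 the correction in the lower bound.\<close>

lemma has_bochner_integral_gaussian_moment:
  fixes p :: real
  assumes "p > 0"
  shows "has_bochner_integral lborel (\<lambda>t. exp (- (p * t\<^sup>2 / 3)) * t ^ (2 * k))
    (sqrt (3 * pi / p) * (fact (2 * k) / ((4 * p / 3) ^ k * fact k)))"
proof -
  define \<sigma> where "\<sigma> = sqrt (3 / (2 * p))"
  have \<sigma>: "\<sigma> > 0" "\<sigma>\<^sup>2 = 3 / (2 * p)"
    using assms by (simp_all add: \<sigma>_def)
  have nd: "sqrt (3 * pi / p) * normal_density 0 \<sigma> t = exp (- (p * t\<^sup>2 / 3))" for t
    using assms by (simp add: normal_density_def \<sigma>(2) field_simps)
  have "has_bochner_integral lborel (\<lambda>t. sqrt (3 * pi / p) * (normal_density 0 \<sigma> t * (t - 0) ^ (2 * k)))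
    (sqrt (3 * pi / p) * (fact (2 * k) / ((2 / \<sigma>\<^sup>2) ^ k * fact k)))"
    by (intro has_bochner_integral_mult_right normal_moment_even \<sigma>)
  then show ?thesis
    by (simp add: \<sigma>(2) mult.assoc[symmetric] nd)
qed

text \<open>The Lagrange remainder of even order is nonnegative for either sign of x.\<close>

lemma exp_ge_Taylor:
  fixes x :: real
  assumes "even n"
  shows "(\<Sum>m<n. x ^ m / fact m) \<le> exp x"
proof -
  obtain t where "exp x = (\<Sum>m<n. x ^ m / fact m) + exp t / fact n * x ^ n"
    using Maclaurin_exp_le[of x n] by blast
  moreover have "0 \<le> exp t / fact n * x ^ n"
    using assms by (simp add: zero_le_even_power)
  ultimately show ?thesis by simp
qed

lemma sin_le_Taylor5:
  fixes x :: real
  assumes "x > 0"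
  shows "sin x \<le> x - x ^ 3 / 6 + x ^ 5 / 120"
proof -
  obtain t where t: "sin x = (\<Sum>m<5. sin_coeff m * x ^ m) + sin (t + 1 / 2 * real 5 * pi) / fact 5 * x ^ 5"
    using Maclaurin_sin_expansion[of x 5] by blast
  have "sin (t + 1 / 2 * real 5 * pi) / fact 5 * x ^ 5 \<le> 1 / fact 5 * x ^ 5"
    using assms by (intro mult_right_mono divide_right_mono) auto
  then show ?thesis
    using t by (simp add: sin_coeff_def lessThan_nat_numeral fact_numeral)
qed

lemma sin_ge_Taylor3:
  fixes x :: real
  assumes "x > 0"
  shows "x - x ^ 3 / 6 \<le> sin x"
proof -
  obtain t where t: "sin x = (\<Sum>m<3. sin_coeff m * x ^ m) + sin (t + 1 / 2 * real 3 * pi) / fact 3 * x ^ 3"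
    using Maclaurin_sin_expansion[of x 3] by blast
  have "- 1 / fact 3 * x ^ 3 \<le> sin (t + 1 / 2 * real 3 * pi) / fact 3 * x ^ 3"
    using assms by (intro mult_right_mono divide_right_mono) auto
  then show ?thesis
    using t by (simp add: sin_coeff_def eval_nat_numeral)
qed

lemma sinc_sq_abs: "sinc_sq \<bar>t\<bar> = sinc_sq t"
  by (cases "t \<ge> 0") (auto simp: sinc_sq_def)

text \<open>With x = t^2 / 6, Taylor gives sin s / s <= 1 - x + 3 x^2 / 10, where s = |t|. This is
  at most 1 - x + x^2 / 2 - x^3 / 6 <= exp (-x) as long as x <= 6/5, that is t^2 <= 36/5. Squaring
  finishes the bound.\<close>

lemma sinc_sq_le_gaussian:
  assumes "t\<^sup>2 \<le> 36 / 5"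
  shows "sinc_sq t \<le> exp (- (t\<^sup>2 / 3))"
proof (cases "t = 0")
  case False
  define s where "s = \<bar>t\<bar>"
  define x where "x = t\<^sup>2 / 6"
  have s: "s > 0" and s2: "s\<^sup>2 = 6 * x" using False by (simp_all add: s_def x_def)
  have x: "0 \<le> x" "x \<le> 6 / 5" using assms by (simp_all add: x_def)
  \<comment> \<open>This secures sin s >= 0, so that squaring preserves the inequality.\<close>
  have "s \<le> pi"
    using s2 x power_mono[of 3 pi 2] pi_gt3 by (intro power2_le_imp_le[of s pi]) auto
  then have "0 \<le> sin s" using s by (intro sin_ge_zero) auto
  have "sin s \<le> s - s ^ 3 / 6 + s ^ 5 / 120"
    by (rule sin_le_Taylor5[OF s])
  also have "\<dots> = s * (1 - s\<^sup>2 / 6 + (s\<^sup>2)\<^sup>2 / 120)"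
    by (simp add: eval_nat_numeral algebra_simps)
  also have "\<dots> = s * (1 - x + 3 / 10 * x\<^sup>2)"
    by (simp add: s2 power_mult_distrib)
  also have "\<dots> \<le> s * (\<Sum>m<4. (- x) ^ m / fact m)"
  proof (rule mult_left_mono)
    have "x\<^sup>2 * x \<le> x\<^sup>2 * (6 / 5)" using x by (intro mult_left_mono) auto
    then show "1 - x + 3 / 10 * x\<^sup>2 \<le> (\<Sum>m<4. (- x) ^ m / fact m)"
      by (simp add: eval_nat_numeral algebra_simps)
  qed (use s in simp)
  also have "\<dots> \<le> s * exp (- x)"
    using s by (intro mult_left_mono exp_ge_Taylor) auto
  finally have "sin s / s \<le> exp (- x)"
    using s by (simp add: field_simps)
  then have "(sin s / s)\<^sup>2 \<le> (exp (- x))\<^sup>2"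
    using \<open>0 \<le> sin s\<close> s by (intro power_mono) auto
  moreover have "sinc_sq t = (sin s / s)\<^sup>2"
    using s sinc_sq_abs[of t] by (simp add: sinc_sq_def s_def power_divide)
  ultimately show ?thesis
    by (simp add: exp_double[symmetric] x_def)
qed (simp add: sinc_sq_def)

text \<open>The cut-off \<open>6 / sqrt 5\<close> is where the Taylor bounds behind the Gaussian estimate stop working.\<close>

lemma ball_integral_less_gaussian_tail:
  assumes p: "p \<ge> 1"
  shows "pi * ball_integral p < sqrt (3 * pi / p) + (sqrt 5 / 6) powr (2 * p - 1) / (p - 1 / 2)"
proof -
  define T where "T = 6 / sqrt 5"
  have T: "T > 0" "T\<^sup>2 = 36 / 5" by (simp_all add: T_def power_divide)
  \<comment> \<open>\<open>c\<close> bounds the Gaussian from below on the strip between T and T +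
    1. There the tail term alone dominates the integrand, so this much of the Gaussian is left over
    and makes the final inequality strict.\<close>
  define c where "c = exp (- (p * (T + 1)\<^sup>2 / 3))"
  let ?tail = "\<lambda>t. indicator {T<..} \<bar>t\<bar> * \<bar>t\<bar> powr (- (2 * p))"
  have tail: "has_bochner_integral lborel ?tail (2 * (T powr (1 - 2 * p) / (2 * p - 1)))"
  proof (rule has_bochner_integral_even_greaterThan)
    have "(\<lambda>t. indicator {0<..} t * ?tail t) = (\<lambda>t. indicator {T<..} t * t powr (- (2 * p)))"
      using T by (auto simp: fun_eq_iff split: split_indicator)
    with has_bochner_integral_powr_tail[OF T(1), of "2 * p"] p
    show "has_bochner_integral lborel (\<lambda>t. indicator {0<..} t * ?tail t) (T powr (1 - 2 * p) / (2 * p - 1))"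
      by simp
  qed simp_all
  have gauss: "has_bochner_integral lborel (\<lambda>t. exp (- (p * t\<^sup>2 / 3))) (sqrt (3 * pi / p))"
    using has_bochner_integral_gaussian_moment[of p 0] p by simp
  have strip: "has_bochner_integral lborel (\<lambda>t. c * indicator {T<..<T + 1} t) (c * 1)"
    by (intro has_bochner_integral_mult_right) (simp add: has_bochner_integral_iff)
  have pw: "sinc_sq t powr p + c * indicator {T<..<T + 1} t \<le> exp (- (p * t\<^sup>2 / 3)) + ?tail t" for t
  proof (cases "\<bar>t\<bar> \<le> T")
    case True
    then have "t\<^sup>2 \<le> 36 / 5"
      using T power_mono[of "\<bar>t\<bar>" T 2] by simp
    then have "sinc_sq t powr p \<le> exp (- (t\<^sup>2 / 3)) powr p"
      using p sinc_sq_nonneg by (intro powr_mono2 sinc_sq_le_gaussian) auto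
    also have "exp (- (t\<^sup>2 / 3)) powr p = exp (- (p * t\<^sup>2 / 3))"
      by (simp add: powr_def)
    finally show ?thesis using True by (auto split: split_indicator)
  next
    case False
    have t: "t \<noteq> 0" using False T by auto
    have "(sin t)\<^sup>2 / t\<^sup>2 \<le> 1 / t\<^sup>2"
      by (intro divide_right_mono) (simp_all add: abs_square_le_1)
    also have "\<dots> = \<bar>t\<bar> powr (- 2)"
      using t by (simp add: powr_minus_divide)
    finally have "sinc_sq t \<le> \<bar>t\<bar> powr (- 2)"
      using t by (simp add: sinc_sq_def)
    then have "sinc_sq t powr p \<le> (\<bar>t\<bar> powr (- 2)) powr p"
      using p sinc_sq_nonneg by (intro powr_mono2) auto
    moreover have "c * indicator {T<..<T + 1} t \<le> exp (- (p * t\<^sup>2 / 3))"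
    proof (cases "t \<in> {T<..<T + 1}")
      case True
      then have "p * t\<^sup>2 \<le> p * (T + 1)\<^sup>2"
        using T p by (intro mult_left_mono power_mono) auto
      then show ?thesis using True by (simp add: c_def)
    qed simp
    ultimately show ?thesis using False by (simp add: powr_powr)
  qed
  have "pi * ball_integral p + c = (LINT t|lborel. sinc_sq t powr p + c * indicator {T<..<T + 1} t)"
    using strip integrable_sinc_sq_powr[OF p] by (simp add: ball_integral_def has_bochner_integral_iff)
  also have "\<dots> \<le> (LINT t|lborel. exp (- (p * t\<^sup>2 / 3)) + ?tail t)"
    using strip integrable_sinc_sq_powr[OF p] tail gauss
    by (intro integral_mono pw Bochner_Integration.integrable_add) (auto simp: has_bochner_integral_iff)
  also have "\<dots> = sqrt (3 * pi / p) + 2 * (T powr (1 - 2 * p) / (2 * p - 1))"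
    using has_bochner_integral_add[OF gauss tail] by (rule has_bochner_integral_integral_eq)
  also have "T powr (1 - 2 * p) = inverse T powr (2 * p - 1)"
    using T powr_minus[of T "2 * p - 1"] by (simp add: inverse_powr)
  also have "inverse T = sqrt 5 / 6" by (simp add: T_def)
  finally have "pi * ball_integral p + c
      \<le> sqrt (3 * pi / p) + (sqrt 5 / 6) powr (2 * p - 1) / (p - 1 / 2)"
    by (simp add: field_simps)
  moreover have "c > 0" by (simp add: c_def)
  ultimately show ?thesis by linarith
qed

text \<open>With x = t^2 / 6, sin s / s >= 1 - x for s = |t|, and ln (1 - x) >= -x - 2 x^2 for x <=
  1/2, so the integrand is at least exp (-2 p x) exp (-4 p x^2). Linearising the second factor
  leaves Gaussian moments of order 0 and 4.\<close>

lemma ball_integral_ge: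
  assumes p: "p \<ge> 2"
  shows "sqrt (3 * pi / p) * (1 - 3 / (4 * p)) \<le> pi * ball_integral p"
proof -
  let ?E = "\<lambda>t. exp (- (p * t\<^sup>2 / 3))"
  have "has_bochner_integral lborel ?E (sqrt (3 * pi / p))"
    using has_bochner_integral_gaussian_moment[of p 0] p by simp
  moreover have "has_bochner_integral lborel (\<lambda>t. p / 9 * (?E t * t ^ 4))
      (p / 9 * (sqrt (3 * pi / p) * (27 / (4 * p\<^sup>2))))"
    using has_bochner_integral_gaussian_moment[of p 2] p
    by (intro has_bochner_integral_mult_right) (simp add: fact_numeral power_divide power_mult_distrib field_simps)
  ultimately have G: "has_bochner_integral lborel (\<lambda>t. ?E t - p / 9 * (?E t * t ^ 4))
      (sqrt (3 * pi / p) - p / 9 * (sqrt (3 * pi / p) * (27 / (4 * p\<^sup>2))))"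
    by (rule has_bochner_integral_diff)
  have pw: "?E t - p / 9 * (?E t * t ^ 4) \<le> sinc_sq t powr p" for t
  proof -
    define x where "x = t\<^sup>2 / 6"
    have t4: "t ^ 4 = 36 * x\<^sup>2" by (simp add: x_def power_divide flip: power_mult)
    have E: "?E t = exp (- (2 * p * x))" by (simp add: x_def)
    have eq: "?E t - p / 9 * (?E t * t ^ 4) = ?E t * (1 - 4 * p * x\<^sup>2)"
      by (simp add: t4 algebra_simps)
    \<comment> \<open>1/2 is the limit of the logarithm bound; beyond it the left-hand side is
      nonpositive.\<close>
    show ?thesis
    proof (cases "x \<le> 1 / 2")
      case False
      then have "(1 / 2)\<^sup>2 \<le> x\<^sup>2" by (intro power_mono) auto
      then have "2 * (1 / 4) \<le> p * x\<^sup>2"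
        using p by (intro mult_mono) (auto simp: power_divide)
      then have "?E t * (1 - 4 * p * x\<^sup>2) \<le> 0"
        by (intro mult_nonneg_nonpos) auto
      then show ?thesis using eq by (metis order_trans powr_ge_zero)
    next
      case True
      show ?thesis
      proof (cases "t = 0")
        case False
        define s where "s = \<bar>t\<bar>"
        have s: "s > 0" "s\<^sup>2 = 6 * x" using False by (simp_all add: s_def x_def)
        have x0: "x \<ge> 0" by (simp add: x_def)
        have "s * (1 - x) = s - s ^ 3 / 6"
          using s(2) by (simp add: power3_eq_cube power2_eq_square algebra_simps)
        also have "\<dots> \<le> sin s" by (rule sin_ge_Taylor3[OF s(1)])
        finally have "1 - x \<le> sin s / s" using s by (simp add: field_simps)
        then have "(1 - x)\<^sup>2 \<le> (sin s / s)\<^sup>2"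
          using True by (intro power_mono) auto
        also have "\<dots> = sinc_sq t"
          using s sinc_sq_abs[of t] by (simp add: sinc_sq_def s_def power_divide)
        finally have sq: "(1 - x)\<^sup>2 \<le> sinc_sq t" .
        have "?E t * (1 - 4 * p * x\<^sup>2) \<le> ?E t * exp (- (4 * p * x\<^sup>2))"
          using exp_ge_add_one_self[of "- (4 * p * x\<^sup>2)"] by (intro mult_left_mono) auto
        also have "\<dots> = exp (2 * p * (- x - 2 * x\<^sup>2))"
          by (simp add: E mult_exp_exp algebra_simps)
        also have "\<dots> \<le> exp (2 * p * ln (1 - x))"
          using p x0 True by (simp add: ln_one_minus_pos_lower_bound)
        also have "\<dots> = ((1 - x)\<^sup>2) powr p"
          using True by (simp add: powr_def ln_realpow)
        also have "\<dots> \<le> sinc_sq t powr p"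
          using p sq by (intro powr_mono2) auto
        finally show ?thesis using eq by simp
      qed (simp add: sinc_sq_def)
    qed
  qed
  have "sqrt (3 * pi / p) * (1 - 3 / (4 * p))
      = sqrt (3 * pi / p) - p / 9 * (sqrt (3 * pi / p) * (27 / (4 * p\<^sup>2)))"
    using p by (simp add: field_simps power2_eq_square)
  also have "\<dots> = (LINT t|lborel. ?E t - p / 9 * (?E t * t ^ 4))"
    by (rule has_bochner_integral_integral_eq[OF G, symmetric])
  also have "\<dots> \<le> (LINT t|lborel. sinc_sq t powr p)"
    using integrable_sinc_sq_powr[of p] G p
    by (intro integral_mono pw) (auto simp: has_bochner_integral_iff)
  finally show ?thesis by (simp add: ball_integral_def)
qed

subsection \<open>The threshold exponent\<close>

text \<open>The expression shared by \<open>p0_equation\<close> and the second branch of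
  \<open>C\<close>. Its strict decrease yields both the uniqueness of \<open>p0\<close> and the
  upper bound on \<open>C\<close> beyond it.\<close>

definition tail_ratio :: "real \<Rightarrow> real" where
  "tail_ratio p = (sqrt 5 / 6) powr (2 * p - 1) / (sqrt p - 1 / (2 * sqrt p))"

lemma tail_ratio_denom: "p > 0 \<Longrightarrow> sqrt p - 1 / (2 * sqrt p) = (p - 1 / 2) / sqrt p"
  by (simp add: field_simps)

lemma sqrt5_less_6: "sqrt 5 < 6"
  by (rule real_less_lsqrt) auto

text \<open>The numerator is a power of a base below 1, and the denominator is positive and
  increasing.\<close>

lemma tail_ratio_strict_antimono:
  assumes "1 \<le> p" "p < q"
  shows "tail_ratio q < tail_ratio p"
proof -
  have "(sqrt 5 / 6) powr (2 * q - 1) < (sqrt 5 / 6) powr (2 * p - 1)"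
    using assms sqrt5_less_6 by (intro powr_less_mono') auto
  moreover have "sqrt p - 1 / (2 * sqrt p) \<le> sqrt q - 1 / (2 * sqrt q)"
    using assms by (intro diff_mono divide_left_mono) auto
  moreover have "0 < sqrt p - 1 / (2 * sqrt p)"
    using assms by (simp add: tail_ratio_denom)
  ultimately show ?thesis
    unfolding tail_ratio_def by (intro frac_less) auto
qed

section \<open>Existence, uniqueness and numerical location of the threshold\<close>

lemma pi_mult_sqrt: "pi * sqrt (3 / pi) = sqrt (3 * pi)"
  by (rule real_sqrt_unique[symmetric]) (simp_all add: power_mult_distrib, simp add: power2_eq_square)

lemma p0_equation_iff: "p0_equation p \<longleftrightarrow> tail_ratio p = pi - sqrt (3 * pi)"
  using pi_mult_sqrt by (simp add: p0_equation_def tail_ratio_def algebra_simps)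

text \<open>7.2 is the squared cut-off 36/5. Writing it as 2^3 / (10/9) leaves logarithms of 2 and
  10/9, for which few series terms suffice.\<close>

lemma ln_7_2_bounds: "1.974081 \<le> ln (7.2 :: real)" "ln (7.2 :: real) \<le> 1.9740811"
proof -
  have "ln (2 ^ 3 :: real) = 3 * ln 2" by (subst ln_realpow) simp_all
  then have eq: "ln (7.2 :: real) = 3 * ln 2 - ln (10 / 9)"
    using ln_div[of "2 ^ 3 :: real" "10 / 9"] by simp
  show "1.974081 \<le> ln (7.2 :: real)" "ln (7.2 :: real) \<le> 1.9740811"
    using ln_approx_bounds[of 2 8] ln_approx_bounds[of "10 / 9" 4] unfolding eq
    by (simp_all add: lessThan_nat_numeral power_one_over)
qed

lemma exp_ge_Taylor8:
  "1 + x + x ^ 2 / 2 + x ^ 3 / 6 + x ^ 4 / 24 + x ^ 5 / 120 + x ^ 6 / 720 + x ^ 7 / 5040 \<le> exp (x::real)"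
  using exp_ge_Taylor[of 8 x] by (simp add: lessThan_nat_numeral fact_numeral algebra_simps)

lemma tail_ratio_eq:
  assumes "p \<ge> 1"
  shows "tail_ratio p = exp (- ((p - 1 / 2) * ln 7.2)) * sqrt p / (p - 1 / 2)"
proof -
  have "sqrt 5 / 6 = sqrt (1 / 7.2)"
    by (rule real_sqrt_unique[symmetric]) (simp_all add: power_divide)
  then have "ln (sqrt 5 / 6) = - ln 7.2 / 2"
    by (simp add: ln_sqrt ln_div)
  then have "(sqrt 5 / 6) powr (2 * p - 1) = exp (- ((p - 1 / 2) * ln 7.2))"
    by (simp add: powr_def field_simps)
  then show ?thesis
    unfolding tail_ratio_def using assms by (simp add: tail_ratio_denom)
qed

lemma sqrt_3_pi_bounds: "3.06998012 \<le> sqrt (3 * pi)" "sqrt (3 * pi) \<le> 3.06998013"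
  using pi_approx by (intro real_le_rsqrt real_le_lsqrt; simp add: power2_eq_square)+

text \<open>The exponent, with 1.34135 = 1.84135 - 1/2, is divided by 4 so that a Taylor polynomial
  of degree 7 is accurate enough; the fourth power is taken afterwards.\<close>

lemma tail_ratio_left: "pi - sqrt (3 * pi) < tail_ratio 1.84135"
proof -
  have "0.515826 \<le> exp (- 0.66198346 :: real)"
    using exp_ge_Taylor8[of "- 0.66198346"] by (rule order_trans[rotated]) (simp add: power_divide)
  also have "\<dots> \<le> exp (- (1.34135 * ln 7.2) / 4)"
    using ln_7_2_bounds by simp
  finally have "0.515826 ^ 4 \<le> exp (- (1.34135 * ln 7.2) / 4 :: real) ^ 4"
    by (rule power_mono) simp
  also have "\<dots> = exp (- (1.34135 * ln 7.2))"
    by (simp flip: exp_of_nat_mult)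
  finally have e: "0.515826 ^ 4 \<le> exp (- (1.34135 * ln (7.2 :: real)))" .
  have "1.35696 \<le> sqrt 1.84135"
    by (rule real_le_rsqrt) (simp add: power2_eq_square)
  with e have "0.515826 ^ 4 * 1.35696 \<le> exp (- (1.34135 * ln (7.2 :: real))) * sqrt 1.84135"
    by (rule mult_mono) simp_all
  moreover have "pi - sqrt (3 * pi) < 0.515826 ^ 4 * 1.35696 / 1.34135"
    using pi_approx sqrt_3_pi_bounds by (simp add: power_divide)
  ultimately show ?thesis
    by (simp add: tail_ratio_eq)
qed

text \<open>Taylor only bounds exp from below, so the upper bound for exp (-y) goes through the
  reciprocal of a lower bound for exp y.\<close>

lemma tail_ratio_right: "tail_ratio 1.84145 < pi - sqrt (3 * pi)"
proof -
  have "1.938727 \<le> exp (0.6620327 :: real)"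
    using exp_ge_Taylor8[of "0.6620327"] by (rule order_trans[rotated]) (simp add: power_divide)
  also have "\<dots> \<le> exp ((1.34145 * ln 7.2) / 4)"
    using ln_7_2_bounds by simp
  finally have "1.938727 ^ 4 \<le> exp ((1.34145 * ln 7.2) / 4 :: real) ^ 4"
    by (rule power_mono) simp
  also have "\<dots> = exp (1.34145 * ln 7.2)"
    by (simp flip: exp_of_nat_mult)
  finally have e: "exp (- (1.34145 * ln (7.2 :: real))) \<le> inverse (1.938727 ^ 4)"
    unfolding exp_minus by (rule le_imp_inverse_le) simp
  have "sqrt 1.84145 \<le> 1.357001"
    by (rule real_le_lsqrt) (simp_all add: power2_eq_square)
  with e have "exp (- (1.34145 * ln (7.2 :: real))) * sqrt 1.84145 \<le> inverse (1.938727 ^ 4) * 1.357001"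
    by (rule mult_mono) simp_all
  moreover have "inverse (1.938727 ^ 4) * 1.357001 / 1.34145 < pi - sqrt (3 * pi)"
    using pi_approx sqrt_3_pi_bounds by (simp add: power_divide)
  ultimately show ?thesis
    by (simp add: tail_ratio_eq)
qed

text \<open>The intermediate value theorem gives a solution between 1.84135 and 1.84145, and
  monotonicity makes it unique. Strictness at both endpoints makes the error bound strict.\<close>

lemma ex1_p0: "\<exists>!p. p \<ge> 1 \<and> p0_equation p"
  and abs_p0_less: "\<bar>p0 - 1.8414\<bar> < 0.00005"
proof -
  have "continuous_on {1.84135..1.84145} tail_ratio"
    unfolding tail_ratio_def[abs_def]
    by (intro continuous_intros) (auto simp: tail_ratio_denom)
  then obtain p where p: "1.84135 \<le> p" "p \<le> 1.84145" "tail_ratio p = pi - sqrt (3 * pi)"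
    using IVT2'[of tail_ratio "1.84145" "pi - sqrt (3 * pi)" "1.84135"] tail_ratio_left tail_ratio_right
    by (auto simp: less_imp_le)
  have uniq: "q = p" if "q \<ge> 1" "p0_equation q" for q
    using that p tail_ratio_strict_antimono[of p q] tail_ratio_strict_antimono[of q p]
    by (cases p q rule: linorder_cases) (auto simp: p0_equation_iff)
  show "\<exists>!p. p \<ge> 1 \<and> p0_equation p"
    using p uniq by (intro ex1I[of _ p]) (auto simp: p0_equation_iff)
  have "p0 = p"
    unfolding p0_def using p uniq by (intro the_equality) (auto simp: p0_equation_iff)
  moreover have "p \<noteq> 1.84135" "p \<noteq> 1.84145"
    using p(3) tail_ratio_left tail_ratio_right by (metis less_irrefl)+
  ultimately show "\<bar>p0 - 1.8414\<bar> < 0.00005"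
    using p by (intro abs_less_iff[THEN iffD2]) auto
qed

lemma tail_ratio_p0: "tail_ratio p0 = pi - sqrt (3 * pi)"
  using theI'[OF ex1_p0] by (simp add: p0_def p0_equation_iff)

lemma pi_div_sqrt: "pi / sqrt (3 * pi) = sqrt (pi / 3)"
proof -
  have nz: "sqrt (3 * pi) \<noteq> 0" by simp
  have "sqrt (pi / 3) * sqrt (3 * pi) = pi"
    unfolding real_sqrt_mult[symmetric] by simp
  then show ?thesis
    unfolding nonzero_divide_eq_eq[OF nz] by (rule sym)
qed

text \<open>Identifies the Gaussian-plus-tail bound with the second branch of \<open>C\<close>, up
  to the factor pi.\<close>

lemma gaussian_tail_eq:
  assumes "p \<ge> 1"
  shows "sqrt (3 * pi / p) + (sqrt 5 / 6) powr (2 * p - 1) / (p - 1 / 2)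
    = pi * ((1 + 1 / sqrt (3 * pi) * tail_ratio p) * (sqrt (3 / pi) / sqrt p))"
proof -
  have "(sqrt 5 / 6) powr (2 * p - 1) / (p - 1 / 2) = tail_ratio p / sqrt p"
    using assms by (simp add: tail_ratio_def tail_ratio_denom)
  moreover have "sqrt (3 * pi / p) = sqrt (3 * pi) / sqrt p"
    by (simp add: real_sqrt_divide)
  moreover have "pi * ((1 + 1 / sqrt (3 * pi) * tail_ratio p) * (sqrt (3 / pi) / sqrt p))
      = pi * sqrt (3 / pi) * (1 + 1 / sqrt (3 * pi) * tail_ratio p) / sqrt p"
    by simp
  ultimately show ?thesis
    unfolding pi_mult_sqrt by (simp add: distrib_left add_divide_distrib)
qed

text \<open>Strictness rules out equality beyond \<open>p0\<close>; validity from 1 on also serves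
  the limit.\<close>

lemma ball_integral_less_tail_ratio:
  assumes "p \<ge> 1"
  shows "ball_integral p < (1 + 1 / sqrt (3 * pi) * tail_ratio p) * (sqrt (3 / pi) / sqrt p)"
  using ball_integral_less_gaussian_tail[OF assms] unfolding gaussian_tail_eq[OF assms]
  by (rule mult_left_less_imp_less) simp

lemma ball_integral_ratio_tendsto:
  "((\<lambda>p. ball_integral p / (sqrt (3 / pi) / sqrt p)) \<longlongrightarrow> 1) at_top"
proof (rule tendsto_sandwich)
  show "((\<lambda>p::real. 1 - 3 / (4 * p)) \<longlongrightarrow> 1) at_top" by real_asymp
  have "((\<lambda>p::real. 1 + 1 / sqrt (3 * pi) * (1 / (sqrt p - 1 / (2 * sqrt p)))) \<longlongrightarrow> 1 + 1 / sqrt (3 * pi) * 0) at_top"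
    by (intro tendsto_intros) real_asymp
  then show "((\<lambda>p::real. 1 + 1 / sqrt (3 * pi) * (1 / (sqrt p - 1 / (2 * sqrt p)))) \<longlongrightarrow> 1) at_top"
    by simp
  show "\<forall>\<^sub>F p in at_top. 1 - 3 / (4 * p) \<le> ball_integral p / (sqrt (3 / pi) / sqrt p)"
    using eventually_ge_at_top[of 2]
  proof eventually_elim
    case (elim p)
    have "sqrt (3 * pi / p) = pi * (sqrt (3 / pi) / sqrt p)"
      unfolding times_divide_eq_right pi_mult_sqrt by (simp add: real_sqrt_divide)
    then have "sqrt (3 * pi / p) * (1 - 3 / (4 * p)) = pi * ((1 - 3 / (4 * p)) * (sqrt (3 / pi) / sqrt p))"
      by (simp only: mult.assoc mult.commute[of "1 - 3 / (4 * p)"])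
    with ball_integral_ge[OF elim]
    have "pi * ((1 - 3 / (4 * p)) * (sqrt (3 / pi) / sqrt p)) \<le> pi * ball_integral p"
      by (simp only:)
    then have "(1 - 3 / (4 * p)) * (sqrt (3 / pi) / sqrt p) \<le> ball_integral p"
      by (rule mult_left_le_imp_le) simp
    moreover have "0 < sqrt (3 / pi) / sqrt p" using elim by simp
    ultimately show ?case
      by (simp only: pos_le_divide_eq)
  qed
  show "\<forall>\<^sub>F p in at_top. ball_integral p / (sqrt (3 / pi) / sqrt p)
      \<le> 1 + 1 / sqrt (3 * pi) * (1 / (sqrt p - 1 / (2 * sqrt p)))"
    using eventually_ge_at_top[of 1]
  proof eventually_elim
    case (elim p)
    \<comment> \<open>Bounding the power by 1 is enough here, as the denominator alone tends to
      infinity.\<close>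
    have "tail_ratio p \<le> 1 / (sqrt p - 1 / (2 * sqrt p))"
      unfolding tail_ratio_def using elim sqrt5_less_6
      by (intro divide_right_mono powr_le1) (auto simp: tail_ratio_denom)
    then have "(1 + 1 / sqrt (3 * pi) * tail_ratio p)
        \<le> 1 + 1 / sqrt (3 * pi) * (1 / (sqrt p - 1 / (2 * sqrt p)))"
      by (intro add_left_mono mult_left_mono) auto
    moreover have "ball_integral p / (sqrt (3 / pi) / sqrt p) \<le> 1 + 1 / sqrt (3 * pi) * tail_ratio p"
      using ball_integral_less_tail_ratio[OF elim] elim by (subst pos_divide_le_eq) auto
    ultimately show ?case by linarith
  qed
qed

theorem theorem1:
  shows "(\<exists>!p::real. p \<ge> 1 \<and> p0_equation p)
    \<and> \<bar>p0 - 1.8414\<bar> < 0.00005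
    \<and> (\<forall>p::real. p \<ge> 1 \<longrightarrow>
          integrable lborel (\<lambda>t. sinc_sq t powr p)
        \<and> ball_integral p \<le> C p * (sqrt (3 / pi) / sqrt p)
        \<and> C p * (sqrt (3 / pi) / sqrt p) \<le> 1 / sqrt p
        \<and> (ball_integral p = C p * (sqrt (3 / pi) / sqrt p) \<longleftrightarrow> p = 1))
    \<and> ((\<lambda>p. ball_integral p / (sqrt (3 / pi) / sqrt p)) \<longlongrightarrow> 1) at_top"
proof (intro conjI allI impI)
  fix p :: real
  assume p: "p \<ge> 1"
  have p0: "1 < p0" "p0 < 2" using abs_less_iff[THEN iffD1, OF abs_p0_less] by simp_all
  have one: "sqrt (pi / 3) * sqrt (3 / pi) = 1"
    by (simp add: real_sqrt_mult[symmetric])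
  have "ball_integral p \<le> C p * (sqrt (3 / pi) / sqrt p)
        \<and> C p * (sqrt (3 / pi) / sqrt p) \<le> 1 / sqrt p
        \<and> (ball_integral p = C p * (sqrt (3 / pi) / sqrt p) \<longleftrightarrow> p = 1)"
  proof (cases "p \<le> p0")
    case True
    \<comment> \<open>On this branch the second and third terms coincide, so the whole claim is the
      comparison with 1 / sqrt p, available because \<open>p0\<close> < 2.\<close>
    have "C p * (sqrt (3 / pi) / sqrt p) = 1 / sqrt p"
      using True one by (simp add: C_def)
    moreover have "ball_integral p < 1 / sqrt p" if "p \<noteq> 1"
      using that p True p0 by (intro ball_integral_less_inverse_sqrt) auto
    ultimately show ?thesis
      using ball_integral_1 by (cases "p = 1") auto
  next
    case False
    then have C: "C p = 1 + 1 / sqrt (3 * pi) * tail_ratio p"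
      by (simp add: C_def tail_ratio_def)
    have "C p \<le> 1 + 1 / sqrt (3 * pi) * tail_ratio p0"
      unfolding C using tail_ratio_strict_antimono[of p0 p] p0 False
      by (intro add_left_mono mult_left_mono) auto
    \<comment> \<open>By the defining equation of \<open>p0\<close>, the second formula for
      \<open>C\<close> takes the constant value of the first branch there.\<close>
    also have "\<dots> = pi / sqrt (3 * pi)"
      unfolding tail_ratio_p0 by (simp add: field_simps)
    also have "\<dots> = sqrt (pi / 3)"
      by (simp only: pi_div_sqrt)
    finally have "C p * (sqrt (3 / pi) / sqrt p) \<le> sqrt (pi / 3) * (sqrt (3 / pi) / sqrt p)"
      using p by (intro mult_right_mono) auto
    also have "\<dots> = 1 / sqrt p" using one by simp
    finally show ?thesis
      using ball_integral_less_tail_ratio[OF p] C False p0 by auto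
  qed
  then show "ball_integral p \<le> C p * (sqrt (3 / pi) / sqrt p)"
    "C p * (sqrt (3 / pi) / sqrt p) \<le> 1 / sqrt p"
    "ball_integral p = C p * (sqrt (3 / pi) / sqrt p) \<longleftrightarrow> p = 1"
    by blast+
qed (fact ex1_p0 abs_p0_less ball_integral_ratio_tendsto | (rule integrable_sinc_sq_powr, assumption))+

end
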